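(* Fix a prime power $q$, and real numbers $0<\tau<1$ and $0<\eta<1$. For every sufficiently large integer $h$ (depending on $q,\tau,\eta$), set $$\ell=\left\lfloor\log_q\left(\frac{(1-\eta)\,h\ln q}{(1+\tau)\ln(1+\tau)-\tau}\right)\right\rfloor,\qquad b=h-\ell.$$ Then there exist a positive integer $n$ with $n=h+\log_q h+O_{q,\tau,\eta}(1)$ and a set $S\subseteq\mathbb F_q^n$ with $|S|=q^h$ such that every linear map $\mathbb F_q^n\to\mathbb F_q^b$ is $\tau$-unbalanced with respect to $S$; moreover, for the same $S$ and every integer $b'>b$, every linear map $\mathbb F_q^n\to\mathbb F_q^{b'}$ is $\tau$-unbalanced with respect to $S$. In particular (taking $\eta=1/2$), a universal guarantee of $\tau$-balance, even with an optimal choice of the map, requires entropy loss at least $\log_q h-O_{q,\tau}(1)$: there is a constant $C'=C'(q,\tau)$ such that for every sufficiently large integer $h$ there exist $n$ and $S\subseteq\mathbb F_q^n$ with $|S|=q^h$ such that any $\tau$-balanced linear map $\mathbb F_q^n\to\mathbb F_q^{b'}$, $b'\ge1$, satisfies $h-b'\ge\log_q h-C'$.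
   Context: For nonempty $S\subseteq\mathbb F_q^n$ and a positive integer $b$, put $\mu=|S|/q^b$. A linear map $L:\mathbb F_q^n\to\mathbb F_q^b$ (not necessarily surjective) is called $\tau$-balanced with respect to $S$ if $(1-\tau)\mu\le|S\cap L^{-1}(y)|\le(1+\tau)\mu$ for every $y\in\mathbb F_q^b$, and $\tau$-unbalanced otherwise. The entropy of $S$ is $h=\log_q|S|$, and the entropy loss of a map to $\mathbb F_q^b$ is $h-b=\log_q\mu$. The notation $O_{q,\tau,\eta}(1)$ denotes a quantity bounded in absolute value by a constant depending only on $q,\tau,\eta$ (similarly $O_{q,\tau}(1)$). *)

theory Defs
  imports Complex_Main "HOL-Library.Cardinality" "Jordan_Normal_Form.VS_Connect"
begin

text \<open>
  The field \<open>\<F>\<^sub>q\<close> is a type \<open>'a :: {field, finite}\<close> with \<open>q = CARD('a)\<close>, and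
  \<open>\<F>\<^sub>q\<^sup>n\<close> is \<^term>\<open>carrier_vec n\<close>, since the dimension has to be quantified inside formulas.
  A linear map is a HOL function that is only constrained on \<^term>\<open>carrier_vec n\<close>.
\<close>

abbreviation linear_vec_map :: "nat \<Rightarrow> nat \<Rightarrow> ('a::field vec \<Rightarrow> 'a vec) \<Rightarrow> bool" where
  "linear_vec_map n b L \<equiv>
     linear_map class_ring (module_vec TYPE('a) n) (module_vec TYPE('a) b) L"

text \<open>
  Balance of \<open>L\<close>, a map into \<open>\<F>\<^sub>q\<^sup>b\<close>, with respect to \<open>S\<close>. The domain dimension is not a
  parameter: \<open>S\<close> is meant to lie in the domain of \<open>L\<close>, so that \<open>S \<inter> L -` {y}\<close> only
  involves values of \<open>L\<close> there.
\<close>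

definition balanced ::
    "real \<Rightarrow> 'a::{field,finite} vec set \<Rightarrow> nat \<Rightarrow> ('a vec \<Rightarrow> 'a vec) \<Rightarrow> bool" where
  "balanced \<tau> S b L \<longleftrightarrow>
     (let \<mu> = real (card S) / real CARD('a) ^ b in
      \<forall>y\<in>carrier_vec b.
        (1 - \<tau>) * \<mu> \<le> real (card (S \<inter> L -` {y})) \<and>
        real (card (S \<inter> L -` {y})) \<le> (1 + \<tau>) * \<mu>)"

abbreviation unbalanced ::
    "real \<Rightarrow> 'a::{field,finite} vec set \<Rightarrow> nat \<Rightarrow> ('a vec \<Rightarrow> 'a vec) \<Rightarrow> bool" where
  "unbalanced \<tau> S b L \<equiv> \<not> balanced \<tau> S b L"

end

theory Submission
  imports Defs
    "HOL-Library.FuncSet"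
    "HOL-Real_Asymp.Real_Asymp"
begin

text \<open>
  A random set \<open>S\<close> defeats all linear maps at once. Let \<open>n = h + d\<close> with \<open>q\<^sup>d \<ge> h\<close>, let \<open>S\<close> be a
  uniformly random subset of \<open>\<F>\<^sub>q\<^sup>n\<close> of size \<open>q\<^sup>h\<close>, and put \<open>\<mu> = q\<^sup>l\<close>, \<open>b = h - l\<close>. A map that is not
  onto has an empty fibre, hence is unbalanced. A surjective linear map to \<open>\<F>\<^sub>q\<^sup>b\<close> splits \<open>\<F>\<^sub>q\<^sup>n\<close>
  into \<open>q\<^sup>b\<close> fibres of equal size, and \<open>S\<close> meets each of them in about \<open>\<mu>\<close> points. As \<open>S\<close> has density
  \<open>q\<^sup>-\<^sup>d \<le> 1/h\<close>, such an intersection behaves like a Poisson variable of mean \<open>\<mu>\<close>, which exceeds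
  \<open>(1 + \<tau>) \<mu>\<close> with probability \<open>p \<approx> exp (- \<phi> \<mu>)\<close>, where \<open>\<phi> = (1 + \<tau>) ln (1 + \<tau>) - \<tau>\<close>.
  Were the fibres independent, the map would have no overfull fibre with probability
  \<open>(1 - p)\<^sup>M \<le> exp (- p M)\<close> for \<open>M = q\<^sup>b\<close>. The choice of \<open>l\<close> makes \<open>\<phi> \<mu> \<le> (1 - \<eta>) h ln q\<close>, so that
  \<open>p M\<close> is at least \<open>q\<^bsup>\<eta> h\<^esup>\<close> up to a power of \<open>h\<close>. There are at most \<open>q\<^bsup>n b\<^esup>\<close> linear maps, that is
  \<open>exp (O(h\<^sup>2))\<close> many, and a union bound wins.
  
  Independence is obtained from weights: when every set \<open>S\<close> is given the weight \<open>x\<^bsup>card S\<^esup>\<close>, the total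
  weight of the sets without overfull fibre is exactly a product over the fibres. The weight \<open>x\<close> is
  chosen so that the size \<open>q\<^sup>h\<close> is the most likely one. Conditioning on this size therefore costs at
  most a factor \<open>q\<^sup>n + 1\<close>, which is harmless
  (\<open>binomial_mode_lower_bound\<close>, \<open>exists_subset_with_overfull_fibres\<close>).
  The lower bound on \<open>p\<close> comes from a single term of the binomial distribution
  (\<open>binomial_term_ge_poisson_term\<close>, \<open>poisson_term_lower_bound\<close>).
  
  Targets of dimension \<open>b' > b\<close> need no new randomness: a balanced map to \<open>\<F>\<^sub>q\<^bsup>b'\<^esup>\<close> followed by the
  projection to the first \<open>b\<close> coordinates is a balanced map to \<open>\<F>\<^sub>q\<^sup>b\<close> (\<open>balanced_vec_first\<close>).
\<close>

section \<open>Subsets with an overfull fibre for every map of a family\<close>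

text \<open>
  The ratio of the terms \<open>j + 1\<close> and \<open>j\<close> is \<open>(V - j) K / ((j + 1) (V - K))\<close>, which passes \<open>1\<close> at
  \<open>j = K\<close>. With this \<open>x\<close> the terms are proportional to the binomial distribution of mean \<open>K\<close>; an
  integral mean is a mode.
\<close>

lemma binomial_term_le_mode:
  fixes V K j :: nat
  assumes K: "K < V"
  defines "x \<equiv> real K / real (V - K)"
  shows "real (V choose j) * x ^ j \<le> real (V choose K) * x ^ K"
proof -
  define a where "a j = real (V choose j) * x ^ j" for j
  have x0: "0 \<le> x" unfolding x_def by simp
  have a0: "0 \<le> a j" for j using x0 unfolding a_def by simp
  have ratio: "a (Suc j) * (real (Suc j) * real (V - K)) = a j * (real (V - j) * real K)" for j
  proof -
    have "Suc j * (V choose Suc j) = (V - j) * (V choose j)"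
      by (simp only: binomial_absorb_comp binomial_absorption)
    hence "real (Suc j) * real (V choose Suc j) = real (V - j) * real (V choose j)"
      by (metis of_nat_mult)
    moreover have "x * real (V - K) = real K" using K unfolding x_def by simp
    moreover have "a (Suc j) * (real (Suc j) * real (V - K))
      = (real (Suc j) * real (V choose Suc j)) * x ^ j * (x * real (V - K))"
      unfolding a_def by (simp add: algebra_simps)
    ultimately have "a (Suc j) * (real (Suc j) * real (V - K))
      = (real (V - j) * real (V choose j)) * x ^ j * real K" by (simp only:)
    thus ?thesis unfolding a_def by (simp only: mult_ac)
  qed
  have up: "a j \<le> a (Suc j)" if "j < K" for j
  proof -
    have "Suc j * (V - K) \<le> (V - j) * K"
    proof -
      obtain d where d: "K = Suc j + d" using less_imp_Suc_add[OF \<open>j < K\<close>] by auto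
      obtain e where e: "V = Suc (K + e)" using less_imp_Suc_add[OF K] by auto
      show ?thesis unfolding e d by (simp add: algebra_simps)
    qed
    hence le: "real (Suc j) * real (V - K) \<le> real (V - j) * real K"
      by (metis of_nat_mono of_nat_mult)
    have "a j * (real (Suc j) * real (V - K)) \<le> a j * (real (V - j) * real K)"
      using le a0 by (intro mult_left_mono)
    also have "\<dots> = a (Suc j) * (real (Suc j) * real (V - K))" using ratio by simp
    finally show ?thesis using K by (simp add: mult_le_cancel_right)
  qed
  have down: "a (Suc j) \<le> a j" if "K \<le> j" for j
  proof -
    have "(V - j) * K \<le> Suc j * (V - K)"
    proof (cases "j \<le> V")
      case True
      obtain d where d: "j = K + d" using le_Suc_ex[OF \<open>K \<le> j\<close>] by auto
      obtain e where e: "V = j + e" using le_Suc_ex[OF True] by auto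
      show ?thesis unfolding e d by (simp add: algebra_simps)
    qed simp
    hence le: "real (V - j) * real K \<le> real (Suc j) * real (V - K)"
      by (metis of_nat_mono of_nat_mult)
    have "a (Suc j) * (real (Suc j) * real (V - K)) = a j * (real (V - j) * real K)" by (fact ratio)
    also have "\<dots> \<le> a j * (real (Suc j) * real (V - K))"
      using le a0 by (intro mult_left_mono)
    finally show ?thesis using K by (simp add: mult_le_cancel_right)
  qed
  have "a j \<le> a K"
  proof (cases "j \<le> K")
    case True
    thus ?thesis
      by (induction rule: inc_induct) (auto intro: order_trans up)
  next
    case False
    hence "K \<le> j" by simp
    thus ?thesis
      by (induction rule: dec_induct) (auto intro: order_trans down)
  qed
  thus ?thesis unfolding a_def .
qed

lemma binomial_mode_lower_bound:
  fixes V K :: nat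
  assumes K: "K < V"
  defines "x \<equiv> real K / real (V - K)"
  shows "(1 + x) ^ V \<le> real (V + 1) * (real (V choose K) * x ^ K)"
proof -
  have "(1 + x) ^ V = (x + 1) ^ V" by (simp add: add.commute)
  also have "\<dots> = (\<Sum>j\<le>V. real (V choose j) * x ^ j)"
    by (subst binomial_ring) simp
  also have "\<dots> \<le> (\<Sum>j\<le>V. real (V choose K) * x ^ K)"
    unfolding x_def by (intro sum_mono binomial_term_le_mode K)
  finally show ?thesis by simp
qed

lemma sum_power_card_Pow:
  fixes x :: "'b::comm_semiring_1"
  assumes "finite F"
  shows "(\<Sum>A\<in>Pow F. x ^ card A) = (1 + x) ^ card F"
  using prod_add[OF assms, of "\<lambda>_. x" "\<lambda>_. 1"] by (simp add: add.commute)

text \<open>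
  Divided by \<open>(1 + x)\<close> to the power of the size of \<open>F\<close>, this bounds the probability that a random
  subset of \<open>F\<close> has at most \<open>T\<close> elements. A single term of the upper tail is enough: in the application
  \<open>k = T + 1\<close> lies above the mean by a constant factor, where the terms decrease geometrically and the
  first one has the order of magnitude of the whole tail.
\<close>

lemma sum_power_card_small_subsets_le:
  fixes x :: real
  assumes F: "finite F" and x: "0 \<le> x" and Tk: "T < k"
  shows "(\<Sum>A | A \<subseteq> F \<and> card A \<le> T. x ^ card A)
       \<le> (1 + x) ^ card F - real (card F choose k) * x ^ k"
proof -
  let ?B = "{A. A \<subseteq> F \<and> card A \<le> T}" and ?C = "{A. A \<subseteq> F \<and> card A = k}"
  have fin: "finite ?B" "finite ?C" using F by auto
  have "(\<Sum>A\<in>?B. x ^ card A) + (\<Sum>A\<in>?C. x ^ card A) = (\<Sum>A\<in>?B \<union> ?C. x ^ card A)"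
    using Tk fin by (subst sum.union_disjoint) auto
  also have "\<dots> \<le> (\<Sum>A\<in>Pow F. x ^ card A)"
    using F x by (intro sum_mono2) auto
  also have "\<dots> = (1 + x) ^ card F" by (rule sum_power_card_Pow[OF F])
  finally show ?thesis using n_subsets[OF F, of k] by simp
qed

lemma binomial_term_le_power:
  fixes x :: real
  assumes "0 \<le> x"
  shows "real (N choose k) * x ^ k \<le> (1 + x) ^ N"
proof (cases "k \<le> N")
  case True
  have "real (N choose k) * x ^ k = (\<Sum>j\<in>{k}. real (N choose j) * x ^ j)" by simp
  also have "\<dots> \<le> (\<Sum>j\<le>N. real (N choose j) * x ^ j)"
    using True assms by (intro sum_mono2) auto
  also have "\<dots> = (x + 1) ^ N" by (subst binomial_ring) simp
  finally show ?thesis by (simp add: add.commute)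
qed (use assms in \<open>simp add: binomial_eq_0\<close>)

text \<open>
  This identity replaces the independence of the fibres: a subset of \<open>V\<close> is the same as a choice of a
  subset of every fibre, and the weight is multiplicative under this correspondence.
\<close>

lemma sum_power_card_fibrewise:
  fixes x :: "'c::comm_semiring_1" and f :: "'a \<Rightarrow> 'b"
  assumes V: "finite V" and Y: "finite Y" and f: "f \<in> V \<rightarrow> Y"
  shows "(\<Sum>S | S \<subseteq> V \<and> (\<forall>y\<in>Y. card (S \<inter> f -` {y}) \<le> T). x ^ card S)
       = (\<Prod>y\<in>Y. \<Sum>A | A \<subseteq> V \<inter> f -` {y} \<and> card A \<le> T. x ^ card A)"
proof -
  let ?P = "\<lambda>y. {A. A \<subseteq> V \<inter> f -` {y} \<and> card A \<le> T}"
  let ?join = "\<lambda>g. \<Union>y\<in>Y. g y"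
  have fib: "?join g \<inter> f -` {y} = g y" if "g \<in> PiE Y ?P" "y \<in> Y" for g y
    using that PiE_mem[OF that(1)] by blast
  have card_fib: "card S = (\<Sum>y\<in>Y. card (S \<inter> f -` {y}))" if "S \<subseteq> V" for S
  proof -
    have "S = (\<Union>y\<in>Y. S \<inter> f -` {y})" using that f by auto
    hence "card S = card (\<Union>y\<in>Y. S \<inter> f -` {y})" by simp
    also have "\<dots> = (\<Sum>y\<in>Y. card (S \<inter> f -` {y}))"
      using Y finite_subset[OF that V] by (intro card_UN_disjoint) auto
    finally show ?thesis .
  qed
  have "(\<Prod>y\<in>Y. \<Sum>A\<in>?P y. x ^ card A) = (\<Sum>g\<in>PiE Y ?P. \<Prod>y\<in>Y. x ^ card (g y))"
    using V by (intro prod_sum_PiE Y) auto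
  also have "\<dots> = (\<Sum>S | S \<subseteq> V \<and> (\<forall>y\<in>Y. card (S \<inter> f -` {y}) \<le> T). x ^ card S)"
  proof (rule sum.reindex_bij_witness
      [where j = ?join and i = "\<lambda>S. \<lambda>y\<in>Y. S \<inter> f -` {y}"])
    fix g assume g: "g \<in> PiE Y ?P"
    show "(\<lambda>y\<in>Y. ?join g \<inter> f -` {y}) = g"
    proof
      fix y show "(\<lambda>y\<in>Y. ?join g \<inter> f -` {y}) y = g y"
        using fib[OF g, of y] PiE_arb[OF g, of y] by (cases "y \<in> Y") auto
    qed
    have sub: "?join g \<subseteq> V" using PiE_mem[OF g] by blast
    show "?join g \<in> {S. S \<subseteq> V \<and> (\<forall>y\<in>Y. card (S \<inter> f -` {y}) \<le> T)}"
      using sub fib[OF g] PiE_mem[OF g] by simp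
    show "x ^ card (?join g) = (\<Prod>y\<in>Y. x ^ card (g y))"
      unfolding card_fib[OF sub] by (simp add: fib[OF g] power_sum)
  next
    fix S assume S: "S \<in> {S. S \<subseteq> V \<and> (\<forall>y\<in>Y. card (S \<inter> f -` {y}) \<le> T)}"
    thus "?join (\<lambda>y\<in>Y. S \<inter> f -` {y}) = S" using f by auto
    show "(\<lambda>y\<in>Y. S \<inter> f -` {y}) \<in> PiE Y ?P" using S by auto
  qed
  finally show ?thesis by simp
qed

text \<open>
  The union bound. Among the subsets of size \<open>K\<close>, the fraction without overfull fibre for one
  given \<open>f\<close> is at most \<open>(card V + 1) (1 - p)\<^bsup>card Y\<^esup>\<close>. The factor \<open>card V + 1\<close> pays for passing from
  subsets of random size to subsets of size \<open>K\<close>.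
\<close>

lemma exists_subset_with_overfull_fibres:
  fixes \<F> :: "('a \<Rightarrow> 'b) set"
  assumes V: "finite V" and Y: "finite Y" and \<F>: "finite \<F>"
    and maps: "\<And>f. f \<in> \<F> \<Longrightarrow> f \<in> V \<rightarrow> Y"
    and fibres: "\<And>f y. f \<in> \<F> \<Longrightarrow> y \<in> Y \<Longrightarrow> card (V \<inter> f -` {y}) = N"
    and K: "0 < K" "K < card V" and Tk: "T < k"
  defines "x \<equiv> real K / real (card V - K)"
  defines "p \<equiv> real (N choose k) * x ^ k / (1 + x) ^ N"
  assumes union_bound: "real (card \<F>) * (real (card V + 1) * (1 - p) ^ card Y) < 1"
  shows "\<exists>S\<subseteq>V. card S = K \<and> (\<forall>f\<in>\<F>. \<exists>y\<in>Y. T < card (S \<inter> f -` {y}))"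
proof (rule ccontr)
  assume none: "\<not> ?thesis"
  have x: "0 < x" using K unfolding x_def by simp
  define bad where "bad f = {S. S \<subseteq> V \<and> card S = K \<and> (\<forall>y\<in>Y. card (S \<inter> f -` {y}) \<le> T)}" for f
  define m where "m = real (card V choose K)"
  have m: "0 < m" using K unfolding m_def by simp
  have "{S. S \<subseteq> V \<and> card S = K} \<subseteq> (\<Union>f\<in>\<F>. bad f)"
    using none unfolding bad_def by (auto simp: not_less) 
  hence "card {S. S \<subseteq> V \<and> card S = K} \<le> card (\<Union>f\<in>\<F>. bad f)"
    using V \<F> by (intro card_mono) (auto simp: bad_def)
  also have "\<dots> \<le> (\<Sum>f\<in>\<F>. card (bad f))" by (rule card_UN_le[OF \<F>])
  finally have "m \<le> (\<Sum>f\<in>\<F>. real (card (bad f)))"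
    unfolding m_def n_subsets[OF V] by (simp flip: of_nat_sum)
  also have "\<dots> \<le> (\<Sum>f\<in>\<F>. m * (real (card V + 1) * (1 - p) ^ card Y))"
  proof (rule sum_mono)
    fix f assume f: "f \<in> \<F>"
    have fib_sum: "card V = N * card Y"
    proof -
      have "V = (\<Union>y\<in>Y. V \<inter> f -` {y})" using maps[OF f] by auto
      hence "card V = card (\<Union>y\<in>Y. V \<inter> f -` {y})" by simp
      also have "\<dots> = (\<Sum>y\<in>Y. card (V \<inter> f -` {y}))"
        using Y V by (intro card_UN_disjoint) auto
      finally show ?thesis using fibres[OF f] by simp
    qed
    have "real (card (bad f)) * x ^ K = (\<Sum>S\<in>bad f. x ^ card S)"
      unfolding bad_def by simp
    also have "\<dots> \<le> (\<Sum>S | S \<subseteq> V \<and> (\<forall>y\<in>Y. card (S \<inter> f -` {y}) \<le> T). x ^ card S)"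
      using V x unfolding bad_def by (intro sum_mono2) auto
    also have "\<dots> = (\<Prod>y\<in>Y. \<Sum>A | A \<subseteq> V \<inter> f -` {y} \<and> card A \<le> T. x ^ card A)"
      by (rule sum_power_card_fibrewise[OF V Y maps[OF f]])
    also have "\<dots> \<le> (\<Prod>y\<in>Y. (1 + x) ^ N * (1 - p))"
    proof (intro prod_mono conjI)
      fix y assume y: "y \<in> Y"
      show "0 \<le> (\<Sum>A | A \<subseteq> V \<inter> f -` {y} \<and> card A \<le> T. x ^ card A)"
        using x by (intro sum_nonneg) auto
      have "(1 + x) ^ N * (1 - p) = (1 + x) ^ N - real (N choose k) * x ^ k"
        using x unfolding p_def by (simp add: field_simps)
      thus "(\<Sum>A | A \<subseteq> V \<inter> f -` {y} \<and> card A \<le> T. x ^ card A) \<le> (1 + x) ^ N * (1 - p)"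
        using sum_power_card_small_subsets_le[of "V \<inter> f -` {y}" x T k] V x Tk fibres[OF f y]
        by simp
    qed
    also have "\<dots> = (1 + x) ^ card V * (1 - p) ^ card Y"
      by (simp add: power_mult_distrib power_mult fib_sum)
    also have "\<dots> \<le> (real (card V + 1) * (m * x ^ K)) * (1 - p) ^ card Y"
    proof (intro mult_right_mono)
      show "(1 + x) ^ card V \<le> real (card V + 1) * (m * x ^ K)"
        unfolding m_def x_def by (rule binomial_mode_lower_bound[OF K(2)])
      have "0 \<le> 1 - p"
        using binomial_term_le_power[of x N k] x unfolding p_def by (simp add: divide_le_eq_1)
      thus "0 \<le> (1 - p) ^ card Y" by simp
    qed
    finally have "real (card (bad f)) * x ^ K
        \<le> (m * (real (card V + 1) * (1 - p) ^ card Y)) * x ^ K" by (simp add: algebra_simps)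
    thus "real (card (bad f)) \<le> m * (real (card V + 1) * (1 - p) ^ card Y)"
      using x by (simp add: mult_le_cancel_right)
  qed
  also have "\<dots> = m * (real (card \<F>) * (real (card V + 1) * (1 - p) ^ card Y))"
    by (simp add: algebra_simps)
  also have "\<dots> < m * 1" using m union_bound by (intro mult_strict_left_mono)
  finally show False by simp
qed

section \<open>Linear maps between coordinate spaces\<close>

lemma bij_betw_carrier_vec_PiE:
  "bij_betw (\<lambda>v. \<lambda>i\<in>{..<n}. v $ i) (carrier_vec n :: 'a vec set) (PiE {..<n} (\<lambda>_. UNIV))"
proof (rule bij_betw_byWitness[where f' = "vec n"])
  show "\<forall>v\<in>carrier_vec n :: 'a vec set. vec n (\<lambda>i\<in>{..<n}. v $ i) = v"
    by (intro ballI eq_vecI) auto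
  show "\<forall>f\<in>PiE {..<n} (\<lambda>_. UNIV :: 'a set). (\<lambda>i\<in>{..<n}. vec n f $ i) = f"
  proof (intro ballI ext)
    fix f :: "nat \<Rightarrow> 'a" and i assume f: "f \<in> PiE {..<n} (\<lambda>_. UNIV)"
    show "(\<lambda>i\<in>{..<n}. vec n f $ i) i = f i"
      using PiE_arb[OF f, of i] by (cases "i < n") simp_all
  qed
  show "(\<lambda>v. \<lambda>i\<in>{..<n}. v $ i) ` (carrier_vec n :: 'a vec set) \<subseteq> PiE {..<n} (\<lambda>_. UNIV)"
    by (intro image_subsetI restrict_PiE_iff[THEN iffD2]) simp
  show "vec n ` PiE {..<n} (\<lambda>_. UNIV :: 'a set) \<subseteq> carrier_vec n"
    by (intro image_subsetI) simp
qed

lemma card_carrier_vec: "card (carrier_vec n :: 'a::finite vec set) = CARD('a) ^ n"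
  unfolding bij_betw_same_card[OF bij_betw_carrier_vec_PiE] by (simp add: card_PiE)

lemma finite_carrier_vec [simp]: "finite (carrier_vec n :: 'a::finite vec set)"
  unfolding bij_betw_finite[OF bij_betw_carrier_vec_PiE] by (simp add: finite_PiE)

text \<open>
  Linear maps are module homomorphisms between records; the next two rules translate them to and from
  vector arithmetic, which is all that is used below.
\<close>

lemma linear_vec_mapD:
  fixes L :: "'a::field vec \<Rightarrow> 'a vec"
  assumes "linear_vec_map n b L"
  shows "L \<in> carrier_vec n \<rightarrow> carrier_vec b"
    and "\<And>u v. u \<in> carrier_vec n \<Longrightarrow> v \<in> carrier_vec n \<Longrightarrow> L (u + v) = L u + L v"
    and "\<And>c v. v \<in> carrier_vec n \<Longrightarrow> L (c \<cdot>\<^sub>v v) = c \<cdot>\<^sub>v L v"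
  using assms
  unfolding linear_map_def mod_hom_def mod_hom_axioms_def LinearCombinations.module_hom_def
  by (auto simp: module_vec_simps)

lemma linear_vec_mapI:
  fixes L :: "'a::field vec \<Rightarrow> 'a vec"
  assumes "L \<in> carrier_vec n \<rightarrow> carrier_vec b"
    and "\<And>u v. u \<in> carrier_vec n \<Longrightarrow> v \<in> carrier_vec n \<Longrightarrow> L (u + v) = L u + L v"
    and "\<And>c v. v \<in> carrier_vec n \<Longrightarrow> L (c \<cdot>\<^sub>v v) = c \<cdot>\<^sub>v L v"
  shows "linear_vec_map n b L"
proof (intro linear_map.intro mod_hom.intro mod_hom_axioms.intro vec_vs vec_module)
  show "L \<in> LinearCombinations.module_hom class_ring (module_vec TYPE('a) n) (module_vec TYPE('a) b)"
    using assms unfolding LinearCombinations.module_hom_def by (simp add: module_vec_simps)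
qed

lemma linear_vec_map_compose:
  fixes L M :: "'a::field vec \<Rightarrow> 'a vec"
  assumes L: "linear_vec_map n b L" and M: "linear_vec_map b c M"
  shows "linear_vec_map n c (M \<circ> L)"
proof -
  note L = linear_vec_mapD[OF L] and M = linear_vec_mapD[OF M]
  show ?thesis
    using L M by (intro linear_vec_mapI) (auto simp: Pi_iff)
qed

lemma linear_vec_map_vec_first:
  assumes "b \<le> n"
  shows "linear_vec_map n b (\<lambda>v :: 'a::field vec. vec_first v b)"
    and "(\<lambda>v :: 'a vec. vec_first v b) ` carrier_vec n = carrier_vec b"
proof -
  show "linear_vec_map n b (\<lambda>v :: 'a vec. vec_first v b)"
    using assms by (intro linear_vec_mapI) (auto simp: vec_first_def)
  have "y \<in> (\<lambda>v. vec_first v b) ` carrier_vec n" if "y \<in> carrier_vec b" for y :: "'a vec"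
  proof (rule image_eqI)
    show "y = vec_first (vec n (\<lambda>i. if i < b then y $ i else 0)) b"
      using that assms by (auto simp: vec_first_def)
  qed simp
  thus "(\<lambda>v :: 'a vec. vec_first v b) ` carrier_vec n = carrier_vec b" by auto
qed

text \<open>
  Each fibre is a translate of the kernel, so all fibres have the same size, and counting the domain
  determines it.
\<close>

lemma card_fibre_surj_linear_vec_map:
  fixes L :: "'a::{field,finite} vec \<Rightarrow> 'a vec"
  assumes lin: "linear_vec_map n b L" and surj: "L ` carrier_vec n = carrier_vec b"
    and y: "y \<in> carrier_vec b"
  shows "b \<le> n" and "card (carrier_vec n \<inter> L -` {y}) = CARD('a) ^ (n - b)"
proof -
  note L = linear_vec_mapD[OF lin]
  let ?q = "CARD('a)"
  let ?F = "\<lambda>y. carrier_vec n \<inter> L -` {y}"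
  have q: "1 < ?q"
    using card_mono[of "UNIV :: 'a set" "{0, 1}"] by simp
  have same: "card (?F z) = card (?F (0\<^sub>v b))" if z: "z \<in> carrier_vec b" for z
  proof -
    obtain u where u: "u \<in> carrier_vec n" "L u = z" using surj z by force
    have "bij_betw (\<lambda>v. v + u) (?F (0\<^sub>v b)) (?F z)"
    proof (rule bij_betw_byWitness[where f' = "\<lambda>v. v - u"])
      show "\<forall>a\<in>?F (0\<^sub>v b). a + u - u = a" "\<forall>a\<in>?F z. a - u + u = a" using u by auto
      show "(\<lambda>v. v + u) ` ?F (0\<^sub>v b) \<subseteq> ?F z" using u z L by auto
      have "L (v - u) = 0\<^sub>v b" if v: "v \<in> carrier_vec n" "L v = z" for v
      proof -
        have "L (v - u) + L u = L (v - u + u)" using u v by (intro L(2)[symmetric]) auto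
        also have "v - u + u = v" using u v by auto
        finally have e: "L (v - u) + z = z" using u v by simp
        have c: "L (v - u) \<in> carrier_vec b" using u v L(1) by auto
        have "L (v - u) = L (v - u) + z - z" using c z by auto
        thus ?thesis using e z by simp
      qed
      thus "(\<lambda>v. v - u) ` ?F z \<subseteq> ?F (0\<^sub>v b)" using u by auto
    qed
    thus ?thesis by (simp add: bij_betw_same_card)
  qed
  have "(carrier_vec n :: 'a vec set) = (\<Union>z\<in>carrier_vec b. ?F z)" using L(1) by auto
  hence "card (carrier_vec n :: 'a vec set) = card (\<Union>z\<in>carrier_vec b. ?F z)" by simp
  also have "\<dots> = (\<Sum>z\<in>carrier_vec b. card (?F z))" by (intro card_UN_disjoint) auto
  also have "\<dots> = (\<Sum>z\<in>(carrier_vec b :: 'a vec set). card (?F (0\<^sub>v b)))"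
    by (intro sum.cong refl same)
  also have "\<dots> = ?q ^ b * card (?F (0\<^sub>v b))" by (simp add: card_carrier_vec)
  finally have eq: "?q ^ n = ?q ^ b * card (?F (0\<^sub>v b))" by (simp add: card_carrier_vec)
  hence "?q ^ b dvd ?q ^ n" by (rule dvdI)
  hence "?q ^ b \<le> ?q ^ n" by (rule dvd_imp_le) simp
  thus bn: "b \<le> n" by (rule power_le_imp_le_exp[OF q])
  have "?q ^ n = ?q ^ b * ?q ^ (n - b)" using bn by (simp flip: power_add)
  hence "?q ^ b * card (?F (0\<^sub>v b)) = ?q ^ b * ?q ^ (n - b)" by (rule trans[OF eq[symmetric]])
  hence "card (?F (0\<^sub>v b)) = ?q ^ (n - b)" by (subst (asm) mult_left_cancel) auto
  thus "card (?F y) = ?q ^ (n - b)" using same[OF y] by simp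
qed

lemma linear_vec_map_eqI:
  fixes L M :: "'a::field vec \<Rightarrow> 'a vec"
  assumes L: "linear_vec_map n b L" and M: "linear_vec_map n b M"
    and unit: "\<And>i. i < n \<Longrightarrow> L (unit_vec n i) = M (unit_vec n i)"
    and v: "v \<in> carrier_vec n"
  shows "L v = M v"
proof -
  note L = linear_vec_mapD[OF L] and M = linear_vec_mapD[OF M]
  \<comment> \<open>The induction is on the length of an initial segment of coordinates that carries \<open>v\<close>.\<close>
  have "L v = M v" if "v \<in> carrier_vec n" "\<And>i. k \<le> i \<Longrightarrow> i < n \<Longrightarrow> v $ i = 0" for k v
    using that
  proof (induction k arbitrary: v)
    case 0
    hence "0 \<cdot>\<^sub>v v = v" by auto
    moreover have "L (0 \<cdot>\<^sub>v v) = M (0 \<cdot>\<^sub>v v)"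
    proof -
      have "0 \<cdot>\<^sub>v x = 0\<^sub>v b" if "x \<in> carrier_vec b" for x :: "'a vec"
        using that by auto
      thus ?thesis using L(1,3) M(1,3) 0(1) by (auto simp: Pi_iff)
    qed
    ultimately show ?case by simp
  next
    case (Suc k)
    show ?case
    proof (cases "k < n")
      case True
      define w where "w = vec n (\<lambda>i. if i = k then 0 else v $ i)"
      have w: "w \<in> carrier_vec n" unfolding w_def by simp
      have "v = w + v $ k \<cdot>\<^sub>v unit_vec n k"
        using Suc.prems True unfolding w_def by (intro eq_vecI) auto
      moreover have "L w = M w"
        using Suc.prems by (intro Suc.IH w) (auto simp: w_def)
      moreover have "L (w + v $ k \<cdot>\<^sub>v unit_vec n k) = L w + v $ k \<cdot>\<^sub>v L (unit_vec n k)"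
        "M (w + v $ k \<cdot>\<^sub>v unit_vec n k) = M w + v $ k \<cdot>\<^sub>v M (unit_vec n k)"
        using w by (simp_all add: L(2,3) M(2,3))
      ultimately show ?thesis using unit[OF True] by metis
    qed (use Suc in auto)
  qed
  from this[of v n] v show ?thesis by simp
qed

text \<open>
  The restriction to the domain makes the set finite: off the domain a linear map is arbitrary.
  A linear map is then determined by its values at the \<open>n\<close> unit vectors.
\<close>

lemma card_linear_vec_maps_le:
  fixes n b :: nat
  defines "Lin \<equiv> {restrict L (carrier_vec n) | L :: 'a::{field,finite} vec \<Rightarrow> 'a vec.
                   linear_vec_map n b L}"
  shows "finite Lin" and "card Lin \<le> CARD('a) ^ (n * b)"
proof -
  let ?E = "PiE {..<n} (\<lambda>_. carrier_vec b :: 'a vec set)"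
  let ?val = "\<lambda>f :: 'a vec \<Rightarrow> 'a vec. \<lambda>i\<in>{..<n}. f (unit_vec n i)"
  have fin: "finite ?E" by (intro finite_PiE) auto
  have inj: "inj_on ?val Lin"
  proof (rule inj_onI)
    fix f g assume f: "f \<in> Lin" and g: "g \<in> Lin" and eq: "?val f = ?val g"
    from f obtain L where L: "f = restrict L (carrier_vec n)" "linear_vec_map n b L"
      unfolding Lin_def by auto
    from g obtain M where M: "g = restrict M (carrier_vec n)" "linear_vec_map n b M"
      unfolding Lin_def by auto
    have "L (unit_vec n i) = M (unit_vec n i)" if "i < n" for i
      using fun_cong[OF eq, of i] that by (simp add: L(1) M(1))
    hence "L v = M v" if "v \<in> carrier_vec n" for v
      using that by (rule linear_vec_map_eqI[OF L(2) M(2)])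
    thus "f = g" unfolding L(1) M(1) by (rule restrict_ext)
  qed
  have sub: "?val ` Lin \<subseteq> ?E"
  proof (intro image_subsetI)
    fix f assume "f \<in> Lin"
    then obtain L where L: "f = restrict L (carrier_vec n)" "linear_vec_map n b L"
      unfolding Lin_def by auto
    show "?val f \<in> ?E"
      using linear_vec_mapD(1)[OF L(2)] unfolding L(1) by (intro PiE_I) (auto simp: Pi_iff)
  qed
  show "finite Lin" using inj sub fin by (metis finite_imageD finite_subset)
  have "card Lin \<le> card ?E" using inj sub fin by (rule card_inj_on_le)
  also have "card ?E = CARD('a) ^ (n * b)"
    by (simp add: card_PiE card_carrier_vec mult.commute flip: power_mult)
  finally show "card Lin \<le> CARD('a) ^ (n * b)" .
qed

lemma balanced_imp_surj:
  fixes L :: "'a::{field,finite} vec \<Rightarrow> 'a vec"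
  assumes "balanced \<tau> S b L" and "\<tau> < 1" and "0 < card S"
    and L: "L \<in> carrier_vec n \<rightarrow> carrier_vec b" and S: "S \<subseteq> carrier_vec n"
  shows "L ` carrier_vec n = carrier_vec b"
proof -
  have "y \<in> L ` carrier_vec n" if y: "y \<in> carrier_vec b" for y
  proof -
    have "0 < (1 - \<tau>) * (real (card S) / real CARD('a) ^ b)"
      using assms by simp
    also have "\<dots> \<le> real (card (S \<inter> L -` {y}))"
      using assms(1) y unfolding balanced_def Let_def by auto
    finally have "S \<inter> L -` {y} \<noteq> {}" by auto
    thus ?thesis using S by auto
  qed
  thus ?thesis using L by auto
qed

text \<open>
  A fibre of the projected map is the union of \<open>q\<^bsup>b' - b\<^esup>\<close> fibres of \<open>L\<close>, and the expected fibre
  sizes differ by the same factor, so the bounds for the fibres of \<open>L\<close> add up to the required ones.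
\<close>

lemma balanced_vec_first:
  fixes L :: "'a::{field,finite} vec \<Rightarrow> 'a vec"
  assumes bal: "balanced \<tau> S b' L" and b: "b \<le> b'"
    and L: "L \<in> carrier_vec n \<rightarrow> carrier_vec b'" and S: "S \<subseteq> carrier_vec n"
  shows "balanced \<tau> S b ((\<lambda>v. vec_first v b) \<circ> L)"
proof -
  let ?P = "\<lambda>v :: 'a vec. vec_first v b"
  let ?q = "CARD('a)"
  define \<mu> where "\<mu> = real (card S) / real ?q ^ b"
  define \<mu>' where "\<mu>' = real (card S) / real ?q ^ b'"
  have "real (?q ^ (b' - b)) * real ?q ^ b = real ?q ^ b'"
    using b by (simp flip: power_add)
  hence \<mu>: "real (?q ^ (b' - b)) * \<mu>' = \<mu>"
    unfolding \<mu>_def \<mu>'_def by (simp only: times_divide_eq_right) (subst frac_eq_eq; simp add: mult_ac)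
  have finS: "finite S" using S by (rule finite_subset) simp
  have "(1 - \<tau>) * \<mu> \<le> real (card (S \<inter> (?P \<circ> L) -` {y})) \<and>
        real (card (S \<inter> (?P \<circ> L) -` {y})) \<le> (1 + \<tau>) * \<mu>" if y: "y \<in> carrier_vec b" for y
  proof -
    let ?Z = "carrier_vec b' \<inter> ?P -` {y}"
    have cZ: "card ?Z = ?q ^ (b' - b)"
      by (rule card_fibre_surj_linear_vec_map(2)[OF linear_vec_map_vec_first[OF b] y])
    have "S \<inter> (?P \<circ> L) -` {y} = (\<Union>z\<in>?Z. S \<inter> L -` {z})" using L S by auto
    hence "card (S \<inter> (?P \<circ> L) -` {y}) = card (\<Union>z\<in>?Z. S \<inter> L -` {z})" by simp
    also have "\<dots> = (\<Sum>z\<in>?Z. card (S \<inter> L -` {z}))"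
      using finS by (intro card_UN_disjoint) auto
    finally have eq: "real (card (S \<inter> (?P \<circ> L) -` {y})) = (\<Sum>z\<in>?Z. real (card (S \<inter> L -` {z})))"
      by simp
    have z: "(1 - \<tau>) * \<mu>' \<le> real (card (S \<inter> L -` {z}))"
      "real (card (S \<inter> L -` {z})) \<le> (1 + \<tau>) * \<mu>'" if "z \<in> ?Z" for z
      using bal that unfolding balanced_def \<mu>'_def Let_def by auto
    have "(1 - \<tau>) * \<mu> = real (card ?Z) * ((1 - \<tau>) * \<mu>')"
      unfolding cZ \<mu>[symmetric] by simp
    also have "\<dots> \<le> (\<Sum>z\<in>?Z. real (card (S \<inter> L -` {z})))"
      using z by (intro sum_bounded_below)
    finally have lower: "(1 - \<tau>) * \<mu> \<le> (\<Sum>z\<in>?Z. real (card (S \<inter> L -` {z})))" .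
    have "(\<Sum>z\<in>?Z. real (card (S \<inter> L -` {z}))) \<le> real (card ?Z) * ((1 + \<tau>) * \<mu>')"
      using z by (intro sum_bounded_above)
    also have "\<dots> = (1 + \<tau>) * \<mu>" unfolding cZ \<mu>[symmetric] by simp
    finally show ?thesis using lower eq by simp
  qed
  thus ?thesis unfolding balanced_def \<mu>_def Let_def by blast
qed

section \<open>A lower bound for the upper tail of the binomial distribution\<close>

lemma one_minus_ge_exp:
  fixes x :: real
  assumes "0 \<le> x" "x \<le> 1 / 2"
  shows "exp (- x - 2 * x\<^sup>2) \<le> 1 - x"
proof -
  have "- x - 2 * x\<^sup>2 \<le> ln (1 - x)" using assms by (rule ln_one_minus_pos_lower_bound)
  hence "exp (- x - 2 * x\<^sup>2) \<le> exp (ln (1 - x))" by simp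
  thus ?thesis using assms by simp
qed

text \<open>
  This weak form of Stirling's formula is sharp up to a factor linear in \<open>m\<close>. The induction step is
  \<open>e \<le> (1 + 1/m)\<^bsup>m + 1\<^esup>\<close>.
\<close>

lemma fact_le_exp_bound:
  assumes "1 \<le> m"
  shows "(fact m :: real) \<le> exp 1 * real m * (real m / exp 1) ^ m"
  using assms
proof (induction rule: dec_induct)
  case (step m)
  have m: "0 < real m" using step by simp
  have "exp 1 * real m ^ Suc m \<le> real (Suc m) ^ Suc m"
  proof -
    have "1 - real m / real (Suc m) \<le> - ln (real m / real (Suc m))"
      using ln_le_minus_one[of "real m / real (Suc m)"] m by simp
    also have "\<dots> = ln (real (Suc m) / real m)" using m by (simp add: ln_div)
    finally have "1 / real (Suc m) \<le> ln (real (Suc m) / real m)"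
      by (simp add: field_simps)
    hence "1 \<le> real (Suc m) * ln (real (Suc m) / real m)" by (simp add: field_simps)
    hence "exp 1 \<le> exp (real (Suc m) * ln (real (Suc m) / real m))" by simp
    also have "\<dots> = (real (Suc m) / real m) ^ Suc m"
      using m by (subst exp_of_nat_mult) simp
    finally show ?thesis using m by (simp add: power_divide field_simps)
  qed
  hence *: "exp 1 * real m * (real m / exp 1) ^ m \<le> (real (Suc m) / exp 1) ^ m * real (Suc m)"
    by (simp add: power_divide field_simps)
  have "(fact (Suc m) :: real) = real (Suc m) * fact m" by simp
  also have "\<dots> \<le> real (Suc m) * (exp 1 * real m * (real m / exp 1) ^ m)"
    by (intro mult_left_mono step.IH) simp
  also have "\<dots> \<le> real (Suc m) * ((real (Suc m) / exp 1) ^ m * real (Suc m))"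
    by (intro mult_left_mono *) simp
  also have "\<dots> = exp 1 * real (Suc m) * (real (Suc m) / exp 1) ^ Suc m"
    by simp
  finally show ?case .
qed simp

text \<open>
  The function \<open>s ln s - s\<close> governs the Poisson weight at \<open>s\<close> times the mean. Its monotonicity allows
  \<open>(1 + \<tau>) \<mu>\<close> to be replaced by its integral part.
\<close>

lemma poisson_rate_mono:
  fixes s t :: real
  assumes "1 \<le> s" "s \<le> t"
  shows "s * ln s - s \<le> t * ln t - t"
proof (rule DERIV_nonneg_imp_nondecreasing[OF assms(2)])
  fix x assume "s \<le> x" "x \<le> t"
  hence x: "1 \<le> x" using assms by simp
  have "((\<lambda>x. x * ln x - x) has_real_derivative ln x) (at x)"
    using x by (auto intro!: derivative_eq_intros)
  thus "\<exists>y. ((\<lambda>x. x * ln x - x) has_real_derivative y) (at x) \<and> 0 \<le> y"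
    using x by auto
qed

lemma poisson_rate_pos:
  fixes t :: real
  assumes "0 < t"
  shows "0 < (1 + t) * ln (1 + t) - t"
proof -
  have "ln (1 / (1 + t)) < 1 / (1 + t) - 1"
    using assms ln_le_minus_one[of "1 / (1 + t)"] ln_eq_minus_one[of "1 / (1 + t)"] by force
  thus ?thesis using assms by (simp add: ln_div field_simps)
qed

text \<open>
  By Stirling, the Poisson weight \<open>\<mu>\<^sup>m e\<^bsup>-\<mu>\<^esup> / m!\<close> at \<open>m = r \<mu>\<close> is about
  \<open>exp (- \<mu> (r ln r - r + 1))\<close>, and \<open>r \<le> 1 + \<tau>\<close>. The statement is about \<open>m + 1\<close>, the first integer
  above \<open>(1 + \<tau>) \<mu>\<close>; the step from \<open>m\<close> to \<open>m + 1\<close> costs at most a factor \<open>3\<close>.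
\<close>

lemma poisson_term_lower_bound:
  fixes \<mu> :: nat and \<tau> :: real
  assumes tau: "0 < \<tau>" "\<tau> < 1" and mu: "1 \<le> \<mu>"
  defines "m \<equiv> nat \<lfloor>(1 + \<tau>) * real \<mu>\<rfloor>"
  shows "exp (- (((1 + \<tau>) * ln (1 + \<tau>) - \<tau>) * real \<mu>)) / (6 * exp 1 * real \<mu>)
       \<le> real \<mu> ^ Suc m / fact (Suc m) * exp (- real \<mu>)"
proof -
  define r where "r = real m / real \<mu>"
  have mu0: "0 < real \<mu>" using mu by simp
  have tmu: "0 < \<tau> * real \<mu>" "\<tau> * real \<mu> < real \<mu>" using tau mu0 by auto
  have m_le: "real m \<le> (1 + \<tau>) * real \<mu>"
    unfolding m_def using tau by simp
  have "int \<mu> \<le> \<lfloor>(1 + \<tau>) * real \<mu>\<rfloor>"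
    using tmu by (simp add: le_floor_iff algebra_simps)
  hence m_ge: "\<mu> \<le> m" unfolding m_def by linarith
  hence m0: "0 < real m" "1 \<le> m" using mu by auto
  \<comment> \<open>The integrality of \<open>\<mu>\<close> has given \<open>\<mu> \<le> m\<close>, which places \<open>r\<close> in the range where the rate increases.\<close>
  have m2: "real m \<le> 2 * real \<mu>" using m_le tmu by (simp add: algebra_simps)
  have r: "1 \<le> r" "r \<le> 1 + \<tau>"
    using m_ge m_le mu0 unfolding r_def by (auto simp: field_simps)
  have "r * ln r - r \<le> (1 + \<tau>) * ln (1 + \<tau>) - (1 + \<tau>)"
    by (rule poisson_rate_mono[OF r])
  hence "real \<mu> * (r * ln r - r) \<le> real \<mu> * ((1 + \<tau>) * ln (1 + \<tau>) - (1 + \<tau>))"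
    using mu0 by (intro mult_left_mono) auto
  moreover have "real \<mu> * (r * ln r - r) = real m * ln r - real m"
  proof -
    have "real \<mu> * (r * ln r - r) = (real \<mu> * r) * ln r - real \<mu> * r"
      by (simp add: algebra_simps)
    thus ?thesis using mu0 unfolding r_def by simp
  qed
  ultimately have rate: "real m * ln r - real m
      \<le> ((1 + \<tau>) * ln (1 + \<tau>) - \<tau>) * real \<mu> - real \<mu>"
    by (simp add: algebra_simps)
  have "exp (- (real m * ln r - real m)) = (exp 1 / r) ^ m"
  proof -
    have "(exp 1 / r) ^ m = exp (real m * (1 - ln r))"
      using r by (subst exp_of_nat_mult) (simp add: exp_diff)
    thus ?thesis by (simp add: algebra_simps)
  qed
  also have "exp 1 / r = real \<mu> / (real m / exp 1)" unfolding r_def by simp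
  finally have e: "exp (- (real m * ln r - real m)) = real \<mu> ^ m / (real m / exp 1) ^ m"
    by (simp add: power_divide power_mult_distrib)
  have "exp (- (((1 + \<tau>) * ln (1 + \<tau>) - \<tau>) * real \<mu>)) / (6 * exp 1 * real \<mu>)
      \<le> exp (- (real m * ln r - real m)) * exp (- real \<mu>) / (6 * exp 1 * real \<mu>)"
    using rate mu0 by (intro divide_right_mono) (auto simp flip: exp_add)
  also have "\<dots> = real \<mu> ^ m / (real m / exp 1) ^ m * exp (- real \<mu>)
      * (1 / (exp 1 * (2 * real \<mu>))) * (1 / 3)" unfolding e by simp
  also have "\<dots> \<le> real \<mu> ^ m / (real m / exp 1) ^ m * exp (- real \<mu>)
      * (1 / (exp 1 * real m)) * (real \<mu> / real (Suc m))"
  proof (intro mult_mono)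
    show "1 / (exp 1 * (2 * real \<mu>)) \<le> 1 / (exp 1 * real m)"
      using m2 m0 by (intro divide_left_mono) auto
    show "1 / 3 \<le> real \<mu> / real (Suc m)" using m2 mu by (simp add: field_simps)
  qed auto
  also have "\<dots> = real \<mu> ^ Suc m / (real (Suc m) * (exp 1 * real m * (real m / exp 1) ^ m))
      * exp (- real \<mu>)" by (simp add: mult_ac)
  also have "\<dots> \<le> real \<mu> ^ Suc m / (real (Suc m) * fact m) * exp (- real \<mu>)"
    using m0 fact_le_exp_bound[OF m0(2)]
    by (intro mult_right_mono divide_left_mono mult_left_mono) auto
  finally show ?thesis by simp
qed

text \<open>
  The induction is on \<open>j\<close>, with \<open>k\<close> fixed, so that each new factor \<open>N - j\<close> is bounded by the same
  \<open>N - k\<close>. The purpose is the case \<open>j = k\<close>.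
\<close>

lemma power_le_fact_times_binomial:
  assumes "j \<le> k" "k \<le> N"
  shows "(N - k) ^ j \<le> fact j * (N choose j)"
  using assms(1)
proof (induction j)
  case (Suc j)
  have "(N - k) ^ Suc j = (N - k) * (N - k) ^ j" by simp
  also have "\<dots> \<le> (N - j) * (fact j * (N choose j))"
    using Suc by (intro mult_mono) auto
  also have "\<dots> = fact j * ((N - j) * (N choose j))" by simp
  also have "(N - j) * (N choose j) = Suc j * (N choose Suc j)"
    by (simp only: binomial_absorb_comp binomial_absorption)
  finally show ?case by (simp add: algebra_simps)
qed simp

text \<open>
  With \<open>\<delta> = 1/Q\<close>, the right-hand side is the probability of \<open>k\<close> successes in \<open>N\<close> trials of
  success probability \<open>\<delta>\<close>, with mean \<open>\<mu>\<close>. The Poisson approximation has an error of order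
  \<open>\<mu> \<delta>\<close> in the exponent: at most \<open>18 \<mu> \<delta>\<close> from the falling factorial, since \<open>k \<le> 3 \<mu>\<close>, and
  \<open>2 \<mu> \<delta>\<close> from the failures. The later application has \<open>\<mu> = O(h)\<close> and \<open>Q \<ge> h\<close>, so the error is
  bounded; this is what the excess \<open>log\<^sub>q h\<close> of the ambient dimension over \<open>h\<close> is for.
\<close>

lemma binomial_term_ge_poisson_term:
  fixes \<mu> Q k :: nat
  assumes Q: "6 \<le> Q" and k: "k \<le> 3 * \<mu>"
  defines "N \<equiv> \<mu> * Q" and "x \<equiv> 1 / (real Q - 1)"
  shows "real \<mu> ^ k / fact k * exp (- real \<mu>) * exp (- (20 * real \<mu> / real Q))
       \<le> real (N choose k) * x ^ k / (1 + x) ^ N"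
proof -
  define \<delta> where "\<delta> = 1 / real Q"
  have \<delta>: "0 < \<delta>" "\<delta> \<le> 1 / 6" using Q unfolding \<delta>_def by (auto simp: field_simps)
  have x: "0 < x" using Q unfolding x_def by simp
  have inv: "1 / (1 + x) = 1 - \<delta>" and x\<delta>: "x = \<delta> * (1 + x)"
    using Q unfolding x_def \<delta>_def by (auto simp: field_simps)
  have N\<delta>: "real N * \<delta> = real \<mu>" using Q unfolding N_def \<delta>_def by simp
  have kN: "k \<le> N"
  proof -
    have "\<mu> * 3 \<le> \<mu> * Q" using Q by (intro mult_le_mono2) simp
    thus ?thesis using k unfolding N_def by linarith
  qed
  have k\<delta>: "real k \<le> 3 * real \<mu>" using k by linarith
  have "exp (- (18 * real \<mu> * \<delta>)) \<le> (1 - 3 * \<delta>) ^ k"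
  proof -
    have "exp (- (18 * real \<mu> * \<delta>)) \<le> exp (real k * (- (6 * \<delta>)))"
      using mult_right_mono[OF k\<delta>, of \<delta>] \<delta> by simp
    also have "\<dots> = exp (- (6 * \<delta>)) ^ k" by (rule exp_of_nat_mult)
    also have "\<dots> \<le> exp (- (3 * \<delta>) - 2 * (3 * \<delta>)\<^sup>2) ^ k"
    proof (intro power_mono)
      have "\<delta> * \<delta> \<le> \<delta> * (1 / 6)" using \<delta> by (intro mult_left_mono) auto
      thus "exp (- (6 * \<delta>)) \<le> exp (- (3 * \<delta>) - 2 * (3 * \<delta>)\<^sup>2)"
        by (simp add: power2_eq_square)
    qed simp
    also have "\<dots> \<le> (1 - 3 * \<delta>) ^ k"
      using \<delta> by (intro power_mono one_minus_ge_exp) auto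
    finally show ?thesis .
  qed
  moreover have "exp (- real \<mu> - 2 * real \<mu> * \<delta>) \<le> (1 - \<delta>) ^ N"
  proof -
    have "real N * (- \<delta> - 2 * \<delta>\<^sup>2) = - (real N * \<delta>) - 2 * (real N * \<delta>) * \<delta>"
      by (simp add: algebra_simps power2_eq_square)
    hence "exp (- real \<mu> - 2 * real \<mu> * \<delta>) = exp (real N * (- \<delta> - 2 * \<delta>\<^sup>2))"
      unfolding N\<delta> by simp
    also have "\<dots> = exp (- \<delta> - 2 * \<delta>\<^sup>2) ^ N" by (rule exp_of_nat_mult)
    also have "\<dots> \<le> (1 - \<delta>) ^ N"
      using \<delta> by (intro power_mono one_minus_ge_exp) auto
    finally show ?thesis .
  qed
  ultimately have "exp (- (18 * real \<mu> * \<delta>)) * exp (- real \<mu> - 2 * real \<mu> * \<delta>)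
      \<le> (1 - 3 * \<delta>) ^ k * (1 - \<delta>) ^ N"
    using \<delta> by (intro mult_mono) auto
  also have "exp (- (18 * real \<mu> * \<delta>)) * exp (- real \<mu> - 2 * real \<mu> * \<delta>)
      = exp (- real \<mu>) * exp (- (20 * real \<mu> / real Q))"
    unfolding \<delta>_def by (simp flip: exp_add)
  finally have exps: "exp (- real \<mu>) * exp (- (20 * real \<mu> / real Q))
      \<le> (1 - 3 * \<delta>) ^ k * (1 - \<delta>) ^ N" .
  have "real \<mu> ^ k / fact k * exp (- real \<mu>) * exp (- (20 * real \<mu> / real Q))
      = real \<mu> ^ k / fact k * (exp (- real \<mu>) * exp (- (20 * real \<mu> / real Q)))"
    by simp
  also have "\<dots> \<le> real \<mu> ^ k / fact k * ((1 - 3 * \<delta>) ^ k * (1 - \<delta>) ^ N)"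
    by (intro mult_left_mono exps) simp
  also have "\<dots> = (real \<mu> * (1 - 3 * \<delta>)) ^ k * (1 - \<delta>) ^ N / fact k"
    by (simp add: power_mult_distrib)
  also have "\<dots> \<le> (real (N - k) * \<delta>) ^ k * (1 - \<delta>) ^ N / fact k"
  proof (intro divide_right_mono mult_right_mono power_mono)
    have "real (N - k) * \<delta> = real \<mu> - real k * \<delta>"
      using kN N\<delta> by (simp add: of_nat_diff algebra_simps)
    moreover have "real k * \<delta> \<le> 3 * real \<mu> * \<delta>"
      using k\<delta> \<delta> by (intro mult_right_mono) auto
    ultimately show "real \<mu> * (1 - 3 * \<delta>) \<le> real (N - k) * \<delta>"
      by (simp add: algebra_simps)
  qed (use \<delta> in auto)
  also have "\<dots> = real ((N - k) ^ k) / fact k * (\<delta> ^ k * (1 - \<delta>) ^ N)"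
    by (simp add: power_mult_distrib)
  also have "\<dots> \<le> real (N choose k) * ((\<delta> * (1 + x)) ^ k * (1 / (1 + x)) ^ N)"
  proof (intro mult_mono power_mono)
    have "real ((N - k) ^ k) \<le> real (fact k * (N choose k))"
      by (intro of_nat_mono power_le_fact_times_binomial order_refl kN)
    thus "real ((N - k) ^ k) / fact k \<le> real (N choose k)" by (simp add: field_simps)
    show "\<delta> \<le> \<delta> * (1 + x)" using \<delta> x by simp
    show "1 - \<delta> \<le> 1 / (1 + x)" using inv by simp
  qed (use \<delta> x in auto)
  also have "\<dots> = real (N choose k) * x ^ k / (1 + x) ^ N"
    unfolding x\<delta>[symmetric] by (simp add: power_one_over)
  finally show ?thesis .
qed

section \<open>Sets that no linear map balances\<close>

text \<open>
  The explicit form of the union bound. The right-hand side of the hypothesis is \<open>p M\<close> with the lower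
  bound for \<open>p\<close> inserted; the left-hand side is the logarithm of \<open>q\<^bsup>n b\<^esup>\<close>, for the linear maps,
  times \<open>q\<^bsup>n + 1\<^esup> \<ge> q\<^sup>n + 1\<close>, for fixing the size of \<open>S\<close>.
\<close>

lemma exists_set_without_balanced_maps:
  fixes h l d :: nat and \<tau> :: real
  assumes tau: "0 < \<tau>" "\<tau> < 1" and l: "l \<le> h"
  defines "q \<equiv> CARD('a::{field,finite})"
  defines "n \<equiv> h + d" and "b \<equiv> h - l" and "\<mu> \<equiv> q ^ l"
  assumes sparse: "6 \<le> q ^ d"
    and bound: "real (n * b + n + 1) * ln (real q)
      < real q ^ b * (exp (- (((1 + \<tau>) * ln (1 + \<tau>) - \<tau>) * real \<mu>)) / (6 * exp 1 * real \<mu>)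
                      * exp (- (20 * real \<mu> / real q ^ d)))"
  shows "\<exists>S :: 'a vec set. S \<subseteq> carrier_vec n \<and> card S = q ^ h \<and>
           (\<forall>b'\<ge>b. \<forall>L. linear_vec_map n b' L \<longrightarrow> unbalanced \<tau> S b' L)"
proof -
  have q: "2 \<le> q"
    using card_mono[of "UNIV :: 'a set" "{0, 1}"] unfolding q_def by simp
  have mu: "1 \<le> \<mu>" "0 < real \<mu>" using q unfolding \<mu>_def by auto
  define V where "V = (carrier_vec n :: 'a vec set)"
  define Y where "Y = (carrier_vec b :: 'a vec set)"
  define N where "N = q ^ (n - b)"
  define K where "K = q ^ h"
  define T where "T = nat \<lfloor>(1 + \<tau>) * real \<mu>\<rfloor>"
  \<comment> \<open>Only surjective maps have fibres of size \<open>N\<close>; the others are dealt with by \<open>balanced_imp_surj\<close>.\<close>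
  define \<F> where "\<F> = {f. f ` V = Y \<and>
      (\<exists>L :: 'a vec \<Rightarrow> 'a vec. f = restrict L V \<and> linear_vec_map n b L)}"
  have cardV: "card V = q ^ n" and cardY: "card Y = q ^ b"
    unfolding V_def Y_def q_def by (simp_all add: card_carrier_vec)
  have N: "N = \<mu> * q ^ d"
    using l unfolding N_def n_def b_def \<mu>_def by (simp add: add.commute flip: power_add)
  have V_eq: "card V = K * q ^ d" unfolding cardV K_def n_def by (simp add: power_add)
  have K: "0 < K" "K < card V" using q sparse unfolding V_eq K_def by auto
  define x where "x = real K / real (card V - K)"
  define p where "p = real (N choose Suc T) * x ^ Suc T / (1 + x) ^ N"
  have x: "x = 1 / (real (q ^ d) - 1)"
  proof -
    have "real (card V - K) = real K * (real (q ^ d) - 1)"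
      using K(2) unfolding V_eq by (simp add: of_nat_diff algebra_simps)
    thus ?thesis using K(1) unfolding x_def by simp
  qed
  have T_le: "Suc T \<le> 3 * \<mu>"
  proof -
    have "real T \<le> (1 + \<tau>) * real \<mu>" unfolding T_def using tau by simp
    also have "\<dots> \<le> 2 * real \<mu>" using tau mu by (intro mult_right_mono) auto
    finally show ?thesis using mu by linarith
  qed
  have p_ge: "exp (- (((1 + \<tau>) * ln (1 + \<tau>) - \<tau>) * real \<mu>)) / (6 * exp 1 * real \<mu>)
      * exp (- (20 * real \<mu> / real q ^ d)) \<le> p"
  proof -
    have "exp (- (((1 + \<tau>) * ln (1 + \<tau>) - \<tau>) * real \<mu>)) / (6 * exp 1 * real \<mu>)
        * exp (- (20 * real \<mu> / real (q ^ d)))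
      \<le> real \<mu> ^ Suc T / fact (Suc T) * exp (- real \<mu>) * exp (- (20 * real \<mu> / real (q ^ d)))"
      by (rule mult_right_mono[OF
            poisson_term_lower_bound[OF tau mu(1), folded T_def] exp_ge_zero])
    also have "\<dots> \<le> p"
      using binomial_term_ge_poisson_term[OF sparse T_le] unfolding p_def N x .
    finally show ?thesis by simp
  qed
  have F_sub: "\<F> \<subseteq> {restrict L (carrier_vec n) | L :: 'a vec \<Rightarrow> 'a vec. linear_vec_map n b L}"
    unfolding \<F>_def V_def by auto
  have finF: "finite \<F>" and cardF: "card \<F> \<le> q ^ (n * b)"
    using F_sub card_linear_vec_maps_le[where ?'a = 'a, of n b] card_mono[OF _ F_sub]
    unfolding q_def by (auto intro: finite_subset)
  have fibres: "card (V \<inter> f -` {y}) = N" if f: "f \<in> \<F>" and y: "y \<in> Y" for f y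
  proof -
    from f obtain L where L: "f = restrict L V" "linear_vec_map n b L" and im: "f ` V = Y"
      unfolding \<F>_def by auto
    have "V \<inter> f -` {y} = V \<inter> L -` {y}" unfolding L(1) by auto
    moreover have "L ` V = Y" using im unfolding L(1) by simp
    ultimately show ?thesis
      using card_fibre_surj_linear_vec_map(2)[OF L(2)] y unfolding V_def Y_def N_def q_def by simp
  qed
  have "p \<le> 1"
  proof -
    have "0 \<le> x" unfolding x_def by simp
    thus ?thesis
      using binomial_term_le_power[of x N "Suc T"] unfolding p_def by (simp add: divide_le_eq_1)
  qed
  have "real (card \<F>) * (real (card V + 1) * (1 - p) ^ card Y)
      \<le> real q ^ (n * b) * (real q ^ (n + 1) * exp (- p) ^ card Y)"
  proof (intro mult_mono)
    show "real (card \<F>) \<le> real q ^ (n * b)" using cardF by (metis of_nat_mono of_nat_power)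
    have "1 \<le> q ^ n" using q by simp
    hence "card V + 1 \<le> q ^ n * 2" unfolding cardV by simp
    also have "\<dots> \<le> q ^ n * q" using q by (intro mult_le_mono2)
    finally have "real (card V + 1) \<le> real (q ^ n * q)" by (rule of_nat_mono)
    thus "real (card V + 1) \<le> real q ^ (n + 1)" by (simp add: mult.commute)
    show "(1 - p) ^ card Y \<le> exp (- p) ^ card Y"
      using exp_ge_add_one_self[of "- p"] \<open>p \<le> 1\<close> by (intro power_mono) auto
  qed (use \<open>p \<le> 1\<close> in auto)
  also have "\<dots> = exp (real (n * b + n + 1) * ln (real q) - real q ^ b * p)"
  proof -
    have "real q ^ i = exp (real i * ln (real q))" for i
      using q by (simp add: exp_of_nat_mult)
    hence "real q ^ (n * b) * real q ^ (n + 1) = exp (real (n * b + n + 1) * ln (real q))"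
      by (metis add.assoc power_add)
    moreover have "exp (- p) ^ card Y = exp (- (real q ^ b * p))"
      unfolding cardY by (simp flip: exp_of_nat_mult)
    ultimately show ?thesis by (simp add: exp_diff exp_minus field_simps)
  qed
  also have "\<dots> < exp 0"
  proof -
    have "real (n * b + n + 1) * ln (real q) < real q ^ b * p"
      using bound mult_left_mono[OF p_ge, of "real q ^ b"] by simp
    thus ?thesis by simp
  qed
  finally have union_bound: "real (card \<F>) * (real (card V + 1) * (1 - p) ^ card Y) < 1" by simp
  have "\<exists>S\<subseteq>V. card S = K \<and> (\<forall>f\<in>\<F>. \<exists>y\<in>Y. T < card (S \<inter> f -` {y}))"
  proof (rule exists_subset_with_overfull_fibres[where N = N and k = "Suc T"])
    show "finite V" "finite Y" unfolding V_def Y_def by simp_all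
    show "f \<in> V \<rightarrow> Y" if "f \<in> \<F>" for f using that unfolding \<F>_def by auto
  qed (use finF fibres K union_bound in \<open>auto simp: p_def x_def\<close>)
  then obtain S where S: "S \<subseteq> V" "card S = K"
    and over: "\<And>f. f \<in> \<F> \<Longrightarrow> \<exists>y\<in>Y. T < card (S \<inter> f -` {y})" by blast
  have unbal: "unbalanced \<tau> S b L" if L: "linear_vec_map n b L" for L
  proof
    assume bal: "balanced \<tau> S b L"
    have "L ` V = Y"
      using balanced_imp_surj[OF bal tau(2)] S K(1) linear_vec_mapD(1)[OF L]
      unfolding V_def Y_def by auto
    hence "restrict L V \<in> \<F>" using L unfolding \<F>_def by auto
    then obtain y where y: "y \<in> Y" "T < card (S \<inter> restrict L V -` {y})" using over by blast
    have "S \<inter> restrict L V -` {y} = S \<inter> L -` {y}" using S(1) by auto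
    moreover have "real (card S) / real q ^ b = real \<mu>"
      using q l unfolding S(2) K_def b_def \<mu>_def by (simp add: power_diff)
    hence "real (card (S \<inter> L -` {y})) \<le> (1 + \<tau>) * real \<mu>"
      using bal y(1) unfolding balanced_def Y_def q_def Let_def by auto
    hence "card (S \<inter> L -` {y}) \<le> T" unfolding T_def by (simp add: le_nat_floor)
    ultimately show False using y(2) by simp
  qed
  have "unbalanced \<tau> S b' L" if b': "b \<le> b'" and L: "linear_vec_map n b' L" for b' L
  proof
    assume "balanced \<tau> S b' L"
    hence "balanced \<tau> S b ((\<lambda>v. vec_first v b) \<circ> L)"
      using b' linear_vec_mapD(1)[OF L] S(1) unfolding V_def by (rule balanced_vec_first)
    thus False
      using unbal linear_vec_map_compose[OF L linear_vec_map_vec_first(1)[OF b']] by blast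
  qed
  thus ?thesis using S unfolding V_def K_def by blast
qed

lemma eventually_quartic_lt_exp:
  fixes a c B :: real
  assumes "0 < a" "0 < c"
  shows "\<forall>\<^sub>F h :: nat in sequentially. B * real h ^ 4 < c * exp (a * real h)"
  using assms by real_asymp

text \<open>
  Here \<open>n = h + \<lceil>log\<^sub>q h\<rceil>\<close>. In terms of \<open>A = (1 - \<eta>) ln q / \<phi>\<close> the choice of \<open>l\<close> says \<open>q\<^sup>l \<le> A h\<close>.
  Hence the union bound needs \<open>O(h\<^sup>2) < c q\<^bsup>\<eta> h\<^esup> / h\<^sup>2\<close>, where one factor \<open>h\<close> in the denominator comes
  from \<open>q\<^sup>b = q\<^sup>h / q\<^sup>l\<close>, the other from the factor \<open>1/\<mu>\<close> in the tail bound.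
\<close>

lemma eventually_exists_set_without_balanced_maps:
  fixes q :: nat and \<tau> \<eta> :: real
  assumes q: "q = CARD('a::{field,finite})"
    and tau: "0 < \<tau>" "\<tau> < 1" and eta: "0 < \<eta>" "\<eta> < 1"
  shows "\<forall>\<^sub>F h :: nat in sequentially.
    let l = \<lfloor>log (real q) ((1 - \<eta>) * real h * ln (real q) / ((1 + \<tau>) * ln (1 + \<tau>) - \<tau>))\<rfloor>;
        b = nat (int h - l)
    in int b = int h - l \<and> 0 < b \<and>
       (\<exists>n (S :: 'a vec set). 0 < n \<and> \<bar>real n - (real h + log (real q) (real h))\<bar> \<le> 1 \<and>
          S \<subseteq> carrier_vec n \<and> card S = q ^ h \<and>
          (\<forall>b'\<ge>b. \<forall>L. linear_vec_map n b' L \<longrightarrow> unbalanced \<tau> S b' L))"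
proof -
  define \<phi> where "\<phi> = (1 + \<tau>) * ln (1 + \<tau>) - \<tau>"
  have \<phi>: "0 < \<phi>" unfolding \<phi>_def by (rule poisson_rate_pos[OF tau(1)])
  have q2: "2 \<le> q"
    using card_mono[of "UNIV :: 'a set" "{0, 1}"] unfolding q by simp
  have lnq: "0 < ln (real q)" using q2 by simp
  define A where "A = (1 - \<eta>) * ln (real q) / \<phi>"
  have A: "0 < A" using \<phi> lnq eta unfolding A_def by simp
  define c where "c = exp (- (20 * A)) / (6 * exp 1 * A\<^sup>2)"
  have c: "0 < c" using A unfolding c_def by simp
  have a: "0 < \<eta> * ln (real q)" using eta lnq by simp
  have "\<forall>\<^sub>F h :: nat in sequentially. 1 \<le> A * real h"
    using A by real_asymp
  moreover have "\<forall>\<^sub>F h :: nat in sequentially. A * real h < exp (ln (real q) * real h)"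
    using A lnq by real_asymp
  moreover have "\<forall>\<^sub>F h :: nat in sequentially.
      7 * ln (real q) * real h ^ 4 < c * exp (\<eta> * ln (real q) * real h)"
    by (rule eventually_quartic_lt_exp[OF a c])
  moreover have "\<forall>\<^sub>F h :: nat in sequentially. 6 \<le> h" by (rule eventually_ge_at_top)
  ultimately show ?thesis
  proof eventually_elim
    case (elim h)
    have h: "6 \<le> real h" using elim(4) by simp
    have pow: "real q ^ i = exp (ln (real q) * real i)" for i
      using q2 by (simp add: exp_of_nat2_mult)
    define l where "l = nat \<lfloor>log (real q) (A * real h)\<rfloor>"
    have "0 \<le> log (real q) (A * real h)" using elim(1) q2 by simp
    hence l_int: "int l = \<lfloor>log (real q) (A * real h)\<rfloor>" unfolding l_def by simp
    have "real l \<le> log (real q) (A * real h)" using l_int by linarith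
    hence "real q powr real l \<le> A * real h" using elim(1) q2 by (subst (asm) le_log_iff) auto
    hence mu: "real q ^ l \<le> A * real h" using q2 by (simp add: powr_realpow)
    hence "real q ^ l < real q ^ h"
      using elim(2) unfolding pow[of h] by (rule le_less_trans)
    hence lh: "l < h" using q2 by (simp add: power_strict_increasing_iff)
    define d where "d = nat \<lceil>log (real q) (real h)\<rceil>"
    have "0 \<le> log (real q) (real h)" using h q2 by simp
    hence d: "log (real q) (real h) \<le> real d" "real d \<le> log (real q) (real h) + 1"
      unfolding d_def by linarith+
    have "real h = real q powr log (real q) (real h)" using h q2 by simp
    also have "\<dots> \<le> real q powr real d" using d(1) q2 by (intro powr_mono) auto
    finally have qd: "real h \<le> real q ^ d" using q2 by (simp add: powr_realpow)
    have "real h < 2 ^ h" by (rule of_nat_less_two_power)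
    also have "\<dots> \<le> real q ^ h" using q2 by (intro power_mono) auto
    finally have "log (real q) (real h) \<le> real h"
      using h q2 by (subst log_le_iff) (auto simp: powr_realpow)
    hence dh: "d \<le> h + 1" using d(2) by linarith
    define b where "b = h - l"
    define n where "n = h + d"
    have "real (n * b + n + 1) * ln (real q) \<le> 7 * ln (real q) * (real h)\<^sup>2"
    proof -
      have n3: "n \<le> 3 * h" using dh elim(4) unfolding n_def by simp
      have "n * b \<le> 3 * h * h" using n3 unfolding b_def by (intro mult_le_mono) auto
      moreover have "h \<le> h * h" "1 \<le> h * h" using elim(4) by auto
      ultimately have "n * b + n + 1 \<le> 7 * (h * h)" using n3 by linarith
      hence "real (n * b + n + 1) \<le> 7 * (real h)\<^sup>2"
        unfolding power2_eq_square by (simp flip: of_nat_mult)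
      thus ?thesis using mult_right_mono[of _ _ "ln (real q)"] lnq by fastforce
    qed
    also have "\<dots> < c * exp (\<eta> * ln (real q) * real h) / (real h)\<^sup>2"
    proof -
      have "7 * ln (real q) * (real h)\<^sup>2 * (real h)\<^sup>2 < c * exp (\<eta> * ln (real q) * real h)"
        using elim(3) by (simp add: power2_eq_square power4_eq_xxxx mult_ac)
      thus ?thesis using h by (subst pos_less_divide_eq) auto
    qed
    also have "exp (\<eta> * ln (real q) * real h)
        = real q ^ h * exp (- ((1 - \<eta>) * ln (real q) * real h))"
      unfolding pow by (simp add: algebra_simps flip: exp_add)
    also have "c * (real q ^ h * exp (- ((1 - \<eta>) * ln (real q) * real h))) / (real h)\<^sup>2 = real q ^ h / (A * real h)
        * (exp (- ((1 - \<eta>) * ln (real q) * real h)) / (6 * exp 1 * (A * real h)) * exp (- (20 * A)))"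
      unfolding c_def by (simp add: power2_eq_square mult_ac)
    \<comment> \<open>\<open>A h\<close> is replaced by the smaller \<open>q\<^sup>l\<close>, and \<open>A\<close> in the last exponent by the smaller \<open>q\<^sup>l / q\<^sup>d\<close>.\<close>
    also have "\<dots> \<le> real q ^ h / real q ^ l * (exp (- (\<phi> * real q ^ l)) / (6 * exp 1 * real q ^ l)
        * exp (- (20 * real q ^ l / real q ^ d)))"
    proof (intro mult_mono divide_left_mono frac_le)
      have "\<phi> * real q ^ l \<le> \<phi> * (A * real h)" using mu \<phi> by (intro mult_left_mono) auto
      thus "exp (- ((1 - \<eta>) * ln (real q) * real h)) \<le> exp (- (\<phi> * real q ^ l))"
        using \<phi> unfolding A_def by (simp add: mult_ac)
      have "real q ^ l / real q ^ d \<le> A * real h / real h"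
        using mu qd h A by (intro frac_le) auto
      thus "exp (- (20 * A)) \<le> exp (- (20 * real q ^ l / real q ^ d))" using h by simp
    qed (use mu q2 A h in auto)
    also have "real q ^ h / real q ^ l = real q ^ b"
      using lh q2 unfolding b_def by (simp add: power_diff)
    finally have "\<exists>S :: 'a vec set. S \<subseteq> carrier_vec n \<and> card S = q ^ h \<and>
        (\<forall>b'\<ge>b. \<forall>L. linear_vec_map n b' L \<longrightarrow> unbalanced \<tau> S b' L)"
      using exists_set_without_balanced_maps[where ?'a = 'a, OF tau, of l h d] lh qd h
      unfolding b_def n_def \<phi>_def q[symmetric] by (simp flip: of_nat_power)
    moreover have "\<bar>real n - (real h + log (real q) (real h))\<bar> \<le> 1"
      using d unfolding n_def by simp
    moreover have "0 < n" using elim(4) unfolding n_def by simp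
    moreover have "\<lfloor>log (real q) ((1 - \<eta>) * real h * ln (real q) / ((1 + \<tau>) * ln (1 + \<tau>) - \<tau>))\<rfloor> = int l"
      unfolding l_int A_def \<phi>_def by (simp add: mult_ac)
    moreover have "nat (int h - int l) = b" "int b = int h - int l" "0 < b"
      using lh unfolding b_def by auto
    ultimately show ?case unfolding Let_def by metis
  qed
qed

theorem theorem1p6:
  fixes q :: nat and \<tau> :: real
  assumes q: "q = CARD('a::{field,finite})"
    and tau: "0 < \<tau>" "\<tau> < 1"
  shows
    "(\<forall>\<eta>::real. 0 < \<eta> \<and> \<eta> < 1 \<longrightarrow>
       (\<exists>C::real. \<forall>\<^sub>F h::nat in sequentially.
          let l = \<lfloor>log (real q)
                    ((1 - \<eta>) * real h * ln (real q) / ((1 + \<tau>) * ln (1 + \<tau>) - \<tau>))\<rfloor>;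
              b = nat (int h - l)
          in int b = int h - l \<and> 0 < b \<and>
             (\<exists>(n::nat) (S :: 'a Matrix.vec set).
                0 < n \<and> \<bar>real n - (real h + log (real q) (real h))\<bar> \<le> C \<and>
                S \<subseteq> carrier_vec n \<and> card S = q ^ h \<and>
                (\<forall>L. linear_vec_map n b L \<longrightarrow> unbalanced \<tau> S b L) \<and>
                (\<forall>b'>b. \<forall>L. linear_vec_map n b' L \<longrightarrow> unbalanced \<tau> S b' L))))
     \<and>
     (\<exists>C'::real. \<forall>\<^sub>F h::nat in sequentially.
        \<exists>(n::nat) (S :: 'a Matrix.vec set).
          0 < n \<and> S \<subseteq> carrier_vec n \<and> card S = q ^ h \<and>
          (\<forall>b'\<ge>1. \<forall>L. linear_vec_map n b' L \<and> balanced \<tau> S b' L \<longrightarrow>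
             real h - real b' \<ge> log (real q) (real h) - C'))"
proof (intro conjI allI impI)
  fix \<eta> :: real assume "0 < \<eta> \<and> \<eta> < 1"
  hence eta: "0 < \<eta>" "\<eta> < 1" by auto
  show "\<exists>C::real. \<forall>\<^sub>F h::nat in sequentially.
          let l = \<lfloor>log (real q)
                    ((1 - \<eta>) * real h * ln (real q) / ((1 + \<tau>) * ln (1 + \<tau>) - \<tau>))\<rfloor>;
              b = nat (int h - l)
          in int b = int h - l \<and> 0 < b \<and>
             (\<exists>(n::nat) (S :: 'a Matrix.vec set).
                0 < n \<and> \<bar>real n - (real h + log (real q) (real h))\<bar> \<le> C \<and>
                S \<subseteq> carrier_vec n \<and> card S = q ^ h \<and>
                (\<forall>L. linear_vec_map n b L \<longrightarrow> unbalanced \<tau> S b L) \<and>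
                (\<forall>b'>b. \<forall>L. linear_vec_map n b' L \<longrightarrow> unbalanced \<tau> S b' L))"
    using eventually_exists_set_without_balanced_maps[OF q tau eta] unfolding Let_def
    by (intro exI[of _ 1]) (elim eventually_mono, meson less_imp_le order_refl)
next
  \<comment> \<open>For \<open>\<eta> = 1/2\<close> the number \<open>l\<close> is the floor of \<open>log\<^sub>q (B h) = log\<^sub>q h + log\<^sub>q B\<close>,
    which suggests \<open>C' = - log\<^sub>q B\<close>.\<close>
  define B where "B = (1 - 1 / 2) * ln (real q) / ((1 + \<tau>) * ln (1 + \<tau>) - \<tau>)"
  have q2: "2 \<le> q"
    using card_mono[of "UNIV :: 'a set" "{0, 1}"] unfolding q by simp
  have B: "0 < B" using poisson_rate_pos[OF tau(1)] q2 unfolding B_def by simp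
  have "\<forall>\<^sub>F h :: nat in sequentially. 0 < h" by (rule eventually_gt_at_top)
  moreover have "0 < (1 / 2 :: real)" "(1 / 2 :: real) < 1" by simp_all
  note eventually_exists_set_without_balanced_maps[OF q tau this]
  ultimately have "\<forall>\<^sub>F h :: nat in sequentially. \<exists>n (S :: 'a vec set).
      0 < n \<and> S \<subseteq> carrier_vec n \<and> card S = q ^ h \<and>
      (\<forall>b'\<ge>1. \<forall>L. linear_vec_map n b' L \<and> balanced \<tau> S b' L \<longrightarrow>
         real h - real b' \<ge> log (real q) (real h) - (- log (real q) B))"
  proof eventually_elim
    case (elim h)
    define l where "l = \<lfloor>log (real q) (B * real h)\<rfloor>"
    have l: "l = \<lfloor>log (real q) ((1 - 1 / 2) * real h * ln (real q) / ((1 + \<tau>) * ln (1 + \<tau>) - \<tau>))\<rfloor>"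
      unfolding l_def B_def by (simp add: mult_ac)
    define b where "b = nat (int h - l)"
    from elim(2) obtain n and S :: "'a vec set" where
      b: "int b = int h - l" and S: "0 < n" "S \<subseteq> carrier_vec n" "card S = q ^ h"
      and un: "\<And>b' L. b \<le> b' \<Longrightarrow> linear_vec_map n b' L \<Longrightarrow> unbalanced \<tau> S b' L"
      unfolding Let_def l[symmetric] b_def[symmetric] by auto
    have "log (real q) (real h) + log (real q) B \<le> real h - real b'"
      if "linear_vec_map n b' L" "balanced \<tau> S b' L" for b' L
    proof -
      have "b' < b" using un that not_le by blast
      \<comment> \<open>The strict inequality gains the \<open>1\<close> that the floor in \<open>l\<close> has lost.\<close>
      hence "l + 1 \<le> int h - int b'" using b by simp
      moreover have "log (real q) (B * real h) \<le> real_of_int (l + 1)"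
        unfolding l_def by linarith
      ultimately have "log (real q) (B * real h) \<le> real h - real b'" by linarith
      thus ?thesis using B elim(1) q2 by (simp add: log_mult add.commute)
    qed
    thus ?case using S by (intro exI[of _ n] exI[of _ S]) auto
  qed
  thus "\<exists>C'::real. \<forall>\<^sub>F h::nat in sequentially.
        \<exists>(n::nat) (S :: 'a Matrix.vec set).
          0 < n \<and> S \<subseteq> carrier_vec n \<and> card S = q ^ h \<and>
          (\<forall>b'\<ge>1. \<forall>L. linear_vec_map n b' L \<and> balanced \<tau> S b' L \<longrightarrow>
             real h - real b' \<ge> log (real q) (real h) - C')" by blast
qed

end
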